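(* Let $n,k,q$ be integers with $1\le k\le n-1$ and $q\ge 2$. Let $X=(X_1,\dots,X_n)$ be a vector of jointly distributed random variables, each taking values in a finite set of cardinality $q$. Then $$\mathcal{C}^{(k)}(X)\le k\binom{n}{k}-k\binom{n-1}{k-1}=k\binom{n-1}{k}.$$
   Context: Shannon entropy is taken with logarithms to base $q$: $H(Y)=\sum_y p(y)\log_q(1/p(y))$. For $A\subseteq\{1,\dots,n\}$ write $X_A=(X_i)_{i\in A}$. For $1\le k\le n-1$, the Cohesion-$k$ measure is $$\mathcal{C}^{(k)}(X)=\sum_{A\subseteq\{1,\dots,n\},\,|A|=k}H(X_A)-\binom{n-1}{k-1}H(X).$$ *)

theory Defs
  imports "HOL-Probability.Probability"
begin

context prob_space
begin

text \<open>The library's entropy takes the reference measure as an argument; counting measure on the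
  range of the variable makes it the Shannon entropy of a discrete variable, as shown in
  \<open>joint_entropy_eq_sum\<close>.\<close>

definition joint_entropy :: "real \<Rightarrow> ('i \<Rightarrow> 'a \<Rightarrow> 'b) \<Rightarrow> 'i set \<Rightarrow> real" where
  "joint_entropy b X A =
     (let Y = (\<lambda>\<omega>. \<lambda>i\<in>A. X i \<omega>) in entropy b (count_space (Y ` space M)) Y)"

definition cohesion :: "real \<Rightarrow> nat \<Rightarrow> nat \<Rightarrow> (nat \<Rightarrow> 'a \<Rightarrow> 'b) \<Rightarrow> real" where
  "cohesion b n k X =
     (\<Sum>A | A \<subseteq> {1..n} \<and> card A = k. joint_entropy b X A)
       - real ((n - 1) choose (k - 1)) * joint_entropy b X {1..n}"

lemma joint_entropy_eq_sum:
  fixes X :: "'i \<Rightarrow> 'a \<Rightarrow> 'b"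
  assumes b: "1 < b" and A: "finite A"
    and fin: "\<And>i. i \<in> A \<Longrightarrow> finite (S i)"
    and X: "\<And>i. i \<in> A \<Longrightarrow> X i \<in> measurable M (count_space (S i))"
  defines "Y \<equiv> (\<lambda>\<omega>. \<lambda>i\<in>A. X i \<omega>)"
  defines "p \<equiv> (\<lambda>y. prob {\<omega> \<in> space M. Y \<omega> = y})"
  shows "joint_entropy b X A = (\<Sum>y\<in>Y ` space M. p y * log b (1 / p y))"
proof -
  interpret information_space M b by unfold_locales (rule b)
  have Xs: "X i \<omega> \<in> S i" if "i \<in> A" "\<omega> \<in> space M" for i \<omega>
    using measurable_space[OF X[OF that(1)] that(2)] by simp
  have "Y ` space M \<subseteq> PiE A S"
    using Xs by (auto simp: Y_def)
  moreover have "finite (PiE A S)"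
    using A fin by (rule finite_PiE)
  ultimately have finY: "finite (Y ` space M)"
    by (rule finite_subset)
  have sf: "simple_function M Y"
    unfolding simple_function_def
  proof (intro conjI finY ballI)
    fix y assume y: "y \<in> Y ` space M"
    then have y_ext: "y \<in> extensional A"
      by (auto simp: Y_def)
    have "Y -` {y} \<inter> space M = {\<omega> \<in> space M. \<forall>i\<in>A. X i \<omega> = y i}"
      using y_ext by (auto simp: Y_def fun_eq_iff extensional_def)
    also have "\<dots> \<in> sets M"
    proof (rule sets.sets_Collect_finite_All[OF _ A])
      fix i assume i: "i \<in> A"
      have "y i \<in> S i"
        using y i Xs by (auto simp: Y_def)
      then have "X i -` {y i} \<inter> space M \<in> sets M"
        by (intro measurable_sets[OF X[OF i]]) auto
      also have "X i -` {y i} \<inter> space M = {\<omega> \<in> space M. X i \<omega> = y i}"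
        by auto
      finally show "{\<omega> \<in> space M. X i \<omega> = y i} \<in> sets M" .
    qed
    finally show "Y -` {y} \<inter> space M \<in> sets M" .
  qed
  have "simple_distributed M Y p"
    by (rule simple_distributedI[OF sf]) (auto simp: p_def vimage_def Int_def conj_commute)
  then have "joint_entropy b X A = - (\<Sum>y\<in>Y ` space M. p y * log b (p y))"
    unfolding joint_entropy_def Let_def Y_def[symmetric] by (rule entropy_simple_distributed)
  also have "\<dots> = (\<Sum>y\<in>Y ` space M. p y * log b (1 / p y))"
    unfolding sum_negf[symmetric]
  proof (rule sum.cong[OF refl])
    fix y
    have "0 \<le> p y" by (simp add: p_def)
    then show "- (p y * log b (p y)) = p y * log b (1 / p y)"
      by (cases "p y = 0") (simp_all add: log_divide)
  qed
  finally show ?thesis .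
qed

end

end

(* Every k-subset A has H(X_A) \<le> min k (H X). Summing over the k-subsets, the bound k suffices
   when H X \<ge> k, and the bound H X suffices when H X \<le> k, because
   (n choose k) - (n-1 choose k-1) = (n-1 choose k) is nonnegative. *)
theory Submission
  imports Defs
begin

context prob_space
begin

text \<open>The range lies in the finite product \<open>PiE A S\<close>, and each fibre is a finite
  intersection of events \<open>X i \<omega> = y i\<close>. This makes the tuple a discrete variable
  to which the entropy facts for simple functions apply.\<close>

lemma simple_function_restrict:
  fixes X :: "'i \<Rightarrow> 'a \<Rightarrow> 'b"
  assumes A: "finite A"
    and fin: "\<And>i. i \<in> A \<Longrightarrow> finite (S i)"
    and X: "\<And>i. i \<in> A \<Longrightarrow> X i \<in> measurable M (count_space (S i))"
  shows "simple_function M (\<lambda>\<omega>. \<lambda>i\<in>A. X i \<omega>)"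
proof -
  let ?Y = "\<lambda>\<omega>. \<lambda>i\<in>A. X i \<omega>"
  have Xs: "X i \<omega> \<in> S i" if "i \<in> A" "\<omega> \<in> space M" for i \<omega>
    using measurable_space[OF X[OF that(1)] that(2)] by simp
  have "?Y ` space M \<subseteq> PiE A S"
    using Xs by auto
  then have "finite (?Y ` space M)"
    using finite_PiE[OF A fin] by (rule finite_subset)
  moreover have "?Y -` {y} \<inter> space M \<in> sets M" if y: "y \<in> ?Y ` space M" for y
  proof -
    \<comment> \<open>Both \<open>y\<close> and the tuple are \<open>undefined\<close> outside
      \<open>A\<close>, so agreement on \<open>A\<close> already gives equality of
      functions.\<close>
    have "y \<in> extensional A"
      using y by auto
    have "?Y -` {y} \<inter> space M = {\<omega> \<in> space M. \<forall>i\<in>A. X i \<omega> = y i}"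
      using \<open>y \<in> extensional A\<close> by (auto simp: fun_eq_iff extensional_def)
    also have "\<dots> \<in> sets M"
    proof (rule sets.sets_Collect_finite_All[OF _ A])
      fix i assume i: "i \<in> A"
      \<comment> \<open>Singletons are measurable in \<open>count_space (S i)\<close> only inside
        \<open>S i\<close>; \<open>y i\<close> lies there because \<open>y\<close> is an attained
        value.\<close>
      then have "{y i} \<subseteq> S i"
        using y Xs by auto
      then have "X i -` {y i} \<inter> space M \<in> sets M"
        by (intro measurable_sets[OF X[OF i]]) auto
      also have "X i -` {y i} \<inter> space M = {\<omega> \<in> space M. X i \<omega> = y i}"
        by auto
      finally show "{\<omega> \<in> space M. X i \<omega> = y i} \<in> sets M" .
    qed
    finally show ?thesis .
  qed
  ultimately show ?thesis
    unfolding simple_function_def by blast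
qed

text \<open>The smaller tuple is a function of the larger one, namely its restriction to
  \<open>A\<close>, and applying a function cannot increase entropy.\<close>

lemma joint_entropy_mono:
  fixes X :: "'i \<Rightarrow> 'a \<Rightarrow> 'b"
  assumes b: "1 < b" and B: "finite B" and AB: "A \<subseteq> B"
    and fin: "\<And>i. i \<in> B \<Longrightarrow> finite (S i)"
    and X: "\<And>i. i \<in> B \<Longrightarrow> X i \<in> measurable M (count_space (S i))"
  shows "joint_entropy b X A \<le> joint_entropy b X B"
proof -
  interpret information_space M b by unfold_locales (rule b)
  have "(\<lambda>\<omega>. \<lambda>i\<in>A. X i \<omega>) = (\<lambda>y. restrict y A) \<circ> (\<lambda>\<omega>. \<lambda>i\<in>B. X i \<omega>)"
    using AB by (auto simp: fun_eq_iff)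
  then show ?thesis
    using entropy_data_processing[OF simple_function_restrict[OF B fin X], where f = "\<lambda>y. restrict y A"]
    by (simp add: joint_entropy_def Let_def)
qed

text \<open>Entropy is at most the logarithm of the number of attained values. There are at most
  \<open>q ^ card A\<close> of them, and the base \<open>q\<close> turns this into
  \<open>card A\<close>.\<close>

lemma joint_entropy_le_card:
  fixes X :: "'i \<Rightarrow> 'a \<Rightarrow> 'b"
  assumes q: "2 \<le> q" and A: "finite A"
    and S: "\<And>i. i \<in> A \<Longrightarrow> finite (S i) \<and> card (S i) = q"
    and X: "\<And>i. i \<in> A \<Longrightarrow> X i \<in> measurable M (count_space (S i))"
  shows "joint_entropy (real q) X A \<le> real (card A)"
proof -
  interpret information_space M "real q" by unfold_locales (use q in simp)
  let ?Y = "\<lambda>\<omega>. \<lambda>i\<in>A. X i \<omega>"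
  have fin: "finite (S i)" if "i \<in> A" for i
    using S that by blast
  have "X i \<omega> \<in> S i" if "i \<in> A" "\<omega> \<in> space M" for i \<omega>
    using measurable_space[OF X[OF that(1)] that(2)] by simp
  then have "?Y ` space M \<subseteq> PiE A S"
    by auto
  then have "card (?Y ` space M) \<le> card (PiE A S)"
    by (intro card_mono finite_PiE A fin)
  also have "\<dots> = q ^ card A"
    using A S by (simp add: card_PiE)
  finally have le: "real (card (?Y ` space M)) \<le> real q ^ card A"
    by (metis of_nat_le_iff of_nat_power)
  have sf: "simple_function M ?Y"
    by (rule simple_function_restrict[OF A fin X])
  \<comment> \<open>A probability space is nonempty, hence so is the range; monotonicity of the
    logarithm needs a positive argument.\<close>
  have pos: "0 < real (card (?Y ` space M))"
    using simple_functionD(1)[OF sf] not_empty by (simp add: card_gt_0_iff)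
  have "joint_entropy (real q) X A \<le> log (real q) (real (card (?Y ` space M)))"
    using entropy_le_card[OF simple_distributedI[OF sf measure_nonneg refl]]
    by (simp add: joint_entropy_def Let_def)
  also have "\<dots> \<le> log (real q) (real q ^ card A)"
    using q pos le by (intro log_mono) auto
  also have "\<dots> = real (card A)"
    using q by (simp add: log_nat_power)
  finally show ?thesis .
qed

end

theorem mainTheorem2:
  fixes M :: "'a measure" and X :: "nat \<Rightarrow> 'a \<Rightarrow> 'b" and S :: "nat \<Rightarrow> 'b set"
    and n k q :: nat
  assumes "prob_space M"
    and "1 \<le> k" and "k \<le> n - 1" and "2 \<le> q"
    and "\<And>i. i \<in> {1..n} \<Longrightarrow> finite (S i) \<and> card (S i) = q"
    and "\<And>i. i \<in> {1..n} \<Longrightarrow> X i \<in> measurable M (count_space (S i))"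
  shows "prob_space.cohesion M (real q) n k X
           \<le> real k * real (n choose k) - real k * real ((n - 1) choose (k - 1))
         \<and> real k * real (n choose k) - real k * real ((n - 1) choose (k - 1))
           = real k * real ((n - 1) choose k)"
proof -
  interpret prob_space M by fact
  define h where "h = joint_entropy (real q) X {1..n}"
  \<comment> \<open>From 1 \<le> k \<le> n - 1 both \<open>n\<close> and \<open>k\<close> are
    positive, so neither subtraction truncates. The identity serves the estimate and the closed form
    alike.\<close>
  have pascal: "n choose k = (n - 1 choose (k - 1)) + (n - 1 choose k)"
    using assms(2,3) by (intro choose_reduce_nat) auto
  have bound: "joint_entropy (real q) X A \<le> min (real k) h"
    if "A \<in> {A. A \<subseteq> {1..n} \<and> card A = k}" for A
  proof -
    from that have A: "A \<subseteq> {1..n}" "card A = k"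
      by auto
    have "joint_entropy (real q) X A \<le> real (card A)"
      using A(1) assms(4-6) by (intro joint_entropy_le_card[where S = S]) (auto intro: finite_subset)
    moreover have "joint_entropy (real q) X A \<le> h"
      unfolding h_def using A(1) assms(4-6) by (intro joint_entropy_mono[where S = S]) auto
    ultimately show ?thesis
      using A(2) by simp
  qed
  have "(\<Sum>A | A \<subseteq> {1..n} \<and> card A = k. joint_entropy (real q) X A)
      \<le> real (n choose k) * min (real k) h"
    using sum_bounded_above[of "{A. A \<subseteq> {1..n} \<and> card A = k}", OF bound]
    by (simp add: n_subsets)
  \<comment> \<open>Pascal's rule regroups the terms so that both binomial weights are nonnegative.
    Then \<open>min (real k) h \<le> real k\<close> and \<open>min (real k) h - h \<le> 0\<close>
    finish without a case split on \<open>h\<close>.\<close>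
  then have "cohesion (real q) n k X
      \<le> real (n - 1 choose k) * min (real k) h
        + real (n - 1 choose (k - 1)) * (min (real k) h - h)"
    by (simp add: cohesion_def h_def pascal algebra_simps)
  also have "\<dots> \<le> real (n - 1 choose k) * real k + real (n - 1 choose (k - 1)) * 0"
    by (intro add_mono mult_left_mono) auto
  finally show ?thesis
    by (simp add: pascal algebra_simps)
qed

end
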